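(* Let $\tau>0$ and let $a\in\mathbb{R}^n$ satisfy $a_1\ge a_2\ge\dots\ge a_n\ge 0$ and $a\ne 0$. Consider the problem $$\min_{s\in\mathbb{R}^n}\ \|s-a\|_2+\tau\|s\|_1.\qquad(\mathrm{P})$$ Then: (i) $\bar s=0$ is optimal to $(\mathrm{P})$ if and only if $\tau\ge\frac{\|a\|_\infty}{\|a\|_2}$. (ii) $\bar s=a$ is optimal to $(\mathrm{P})$ if and only if $0<\tau\le\frac{1}{\sqrt{\|a\|_0}}$. (iii) Suppose that $\tau\in\big(\frac{1}{\sqrt{\|a\|_0}},\frac{\|a\|_\infty}{\|a\|_2}\big)$. Let $\bar k$ be the largest integer strictly less than $1/\tau^2$. Then $1\le\bar k\le\|a\|_0-1\le n-1$, and there exists a unique $k\in\{1,2,\dots,\bar k\}$ such that $$a_{k+1}\le t_k:=\sqrt{\frac{a_{k+1}^2+\dots+a_n^2}{\frac{1}{\tau^2}-k}}<a_k.$$ For this $k$, the vector $\bar s:=\max(a-t_k1_n,0)=[a_1-t_k;\dots;a_k-t_k;0;\dots;0]$ is optimal to $(\mathrm{P})$.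
   Context: $\|a\|_0$ denotes the number of nonzero entries of $a$; $\|\cdot\|_1,\|\cdot\|_2,\|\cdot\|_\infty$ are the usual vector norms; $1_n\in\mathbb{R}^n$ is the vector of all ones; the maximum with $0$ is taken entrywise. *)

theory Defs
  imports "HOL-Analysis.Analysis"
begin

text \<open>
  The Euclidean norm and the maximum norm of \<^typ>\<open>real ^ 'n\<close> are \<^const>\<open>norm\<close> and \<^const>\<open>infnorm\<close>.
\<close>

definition l0_norm :: "real ^ 'n \<Rightarrow> nat" where
  "l0_norm x = card {i. x $ i \<noteq> 0}"

definition l1_norm :: "real ^ 'n \<Rightarrow> real" where
  "l1_norm x = (\<Sum>i\<in>UNIV. \<bar>x $ i\<bar>)"

definition objective :: "real \<Rightarrow> real ^ 'n \<Rightarrow> real ^ 'n \<Rightarrow> real" where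
  "objective \<tau> a s = norm (s - a) + \<tau> * l1_norm s"

definition optimal :: "real \<Rightarrow> real ^ 'n \<Rightarrow> real ^ 'n \<Rightarrow> bool" where
  "optimal \<tau> a s \<longleftrightarrow> is_arg_min (objective \<tau> a) (\<lambda>_. True) s"

definition max_zero :: "real ^ 'n \<Rightarrow> real ^ 'n" where
  "max_zero x = (\<chi> i. max (x $ i) 0)"

text \<open>
  The function \<open>e\<close> numbers the coordinates as \<open>1, \<dots>, CARD('n)\<close>, so the informal component
  \<open>a\<^sub>j\<close> is \<open>a $ e j\<close>.
\<close>

definition threshold :: "(nat \<Rightarrow> 'n) \<Rightarrow> real \<Rightarrow> real ^ 'n \<Rightarrow> nat \<Rightarrow> real" where
  "threshold e \<tau> a k =
     sqrt ((\<Sum>j = k + 1..CARD('n). (a $ e j)\<^sup>2) / (1 / \<tau>\<^sup>2 - real k))"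

end

theory Submission
  imports Defs
begin

text \<open>
  Optimality is certified by weak duality: if \<open>norm y \<le> 1\<close> and every \<open>\<bar>y\<^sub>i\<bar> \<le> \<tau>\<close>, then
  \<open>y \<bullet> a = y \<bullet> (a - s) + y \<bullet> s\<close> is a lower bound for the objective at every \<open>s\<close>
  (\<open>optimal_by_dual_certificate\<close>). The certificates are \<open>a / norm a\<close> for the point \<open>0\<close>, the
  vector \<open>\<tau> sgn a\<close> for the point \<open>a\<close>, and \<open>(\<tau> / t) min a t\<close> for the point \<open>max (a - t) 0\<close>.
  The last one has norm 1 exactly when \<open>\<tau>\<^sup>2 (\<Sum>\<^sub>i min(a\<^sub>i, t)\<^sup>2) = t\<^sup>2\<close>. Conversely, if \<open>\<tau>\<close> violates
  the bound in (i) or in (ii), an explicit small step lowers the objective: away from \<open>0\<close> along a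
  largest coordinate of \<open>a\<close>, or away from \<open>a\<close> by shrinking all its nonzero entries equally.

  In (iii) the certificate condition becomes \<open>t = t\<^sub>k\<close> once \<open>k\<close> entries exceed \<open>t\<close> and the others do
  not. With \<open>r = 1 / \<tau>\<^sup>2\<close>, put
  \<open>h k = a\<^sub>k\<^sub>+\<^sub>1\<^sup>2 + \<dots> + a\<^sub>n\<^sup>2 - (r - k) a\<^sub>k\<^sub>+\<^sub>1\<^sup>2\<close>. Then \<open>a\<^sub>k\<^sub>+\<^sub>1 \<le> t\<^sub>k\<close> says \<open>h k \<ge> 0\<close>, and
  \<open>t\<^sub>k < a\<^sub>k\<close> says \<open>h (k - 1) < 0\<close>, because passing from \<open>k\<close> to \<open>k - 1\<close> adds \<open>a\<^sub>k\<^sup>2\<close> to both sides of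
  \<open>a\<^sub>k\<^sub>+\<^sub>1\<^sup>2 + \<dots> + a\<^sub>n\<^sup>2 < (r - k) a\<^sub>k\<^sup>2\<close>. Since
  \<open>h k - h (k - 1) = (r - k) (a\<^sub>k\<^sup>2 - a\<^sub>k\<^sub>+\<^sub>1\<^sup>2) \<ge> 0\<close> for \<open>k < r\<close>, the required \<open>k\<close> is the sign change
  of a nondecreasing sequence. It is negative at \<open>0\<close> because \<open>\<tau>\<close> is below the bound in (i), and
  nonnegative at the last \<open>k < r\<close> because there \<open>r - k \<le> 1\<close>.
\<close>

section \<open>Optimality by weak duality\<close>

lemma optimal_iff: "optimal \<tau> a s \<longleftrightarrow> (\<forall>x. objective \<tau> a s \<le> objective \<tau> a x)"
  by (auto simp: optimal_def is_arg_min_def not_less)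

text \<open>The first summand of \<open>y \<bullet> (a - x) + y \<bullet> x\<close> is bounded by Cauchy-Schwarz, the second by the
  duality of the maximum norm and the 1-norm.\<close>

lemma optimal_by_dual_certificate:
  fixes a s y :: "real ^ 'n"
  assumes "norm y \<le> 1" and "\<And>i. \<bar>y $ i\<bar> \<le> \<tau>" and "objective \<tau> a s \<le> y \<bullet> a"
  shows "optimal \<tau> a s"
  unfolding optimal_iff
proof
  fix x :: "real ^ 'n"
  have "y \<bullet> (a - x) \<le> norm y * norm (a - x)"
    by (rule norm_cauchy_schwarz)
  also have "\<dots> \<le> norm (x - a)"
    using mult_right_mono[OF assms(1), of "norm (a - x)"] by (simp add: norm_minus_commute)
  finally have "y \<bullet> (a - x) \<le> norm (x - a)" .
  moreover have "y \<bullet> x \<le> \<tau> * l1_norm x"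
    unfolding inner_vec_def l1_norm_def sum_distrib_left
  proof (rule sum_mono)
    fix i
    have "y $ i * x $ i \<le> \<bar>y $ i\<bar> * \<bar>x $ i\<bar>"
      by (metis abs_ge_self abs_mult)
    also have "\<dots> \<le> \<tau> * \<bar>x $ i\<bar>"
      by (simp add: assms(2) mult_right_mono)
    finally show "y $ i \<bullet> x $ i \<le> \<tau> * \<bar>x $ i\<bar>" by simp
  qed
  ultimately show "objective \<tau> a s \<le> objective \<tau> a x"
    using assms(3) by (simp add: objective_def inner_diff_right)
qed

section \<open>Optimality of the origin and of the given vector\<close>

lemma infnorm_attained:
  fixes a :: "real ^ 'n"
  obtains i where "infnorm a = \<bar>a $ i\<bar>" and "\<And>j. \<bar>a $ j\<bar> \<le> \<bar>a $ i\<bar>"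
proof -
  let ?A = "range (\<lambda>i. \<bar>a $ i\<bar>)"
  have "Max ?A \<in> ?A" by (rule Max_in) auto
  then obtain i where i: "Max ?A = \<bar>a $ i\<bar>" unfolding image_iff by blast
  have le: "\<bar>a $ j\<bar> \<le> \<bar>a $ i\<bar>" for j
    unfolding i[symmetric] by (rule Max_ge) auto
  have "infnorm a = Sup ?A" by (simp add: infnorm_cart full_SetCompr_eq)
  also have "\<dots> = \<bar>a $ i\<bar>"
    by (rule cSup_eq_maximum) (auto simp: le)
  finally show thesis using le that by blast
qed

text \<open>Let \<open>a\<^sub>i\<close> be an entry of largest modulus and \<open>\<epsilon> = \<bar>a\<^sub>i\<bar> - \<tau> norm a\<close>. Along coordinate \<open>i\<close>, in the
  direction of the sign of \<open>a\<^sub>i\<close>, the objective leaves \<open>0\<close> with slope \<open>- \<epsilon> / norm a\<close>, so \<open>0\<close> is not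
  optimal if \<open>\<epsilon> > 0\<close>. A step of length \<open>\<epsilon>\<close> itself is short enough to lower the objective: the
  point \<open>s\<close> that it reaches satisfies \<open>(norm a - \<tau> \<epsilon>)\<^sup>2 - (norm (s - a))\<^sup>2 = \<epsilon>\<^sup>2 (1 + \<tau>\<^sup>2)\<close>.\<close>

lemma optimal_zero_iff:
  fixes a :: "real ^ 'n"
  assumes "\<tau> > 0" and "a \<noteq> 0"
  shows "optimal \<tau> a 0 \<longleftrightarrow> \<tau> \<ge> infnorm a / norm a"
proof
  have N: "norm a > 0" using assms by simp
  obtain i where i: "infnorm a = \<bar>a $ i\<bar>" and le: "\<And>j. \<bar>a $ j\<bar> \<le> \<bar>a $ i\<bar>"
    using infnorm_attained[of a] by blast
  have l0: "l1_norm (0 :: real ^ 'n) = 0" by (simp add: l1_norm_def)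
  {
    assume "\<tau> \<ge> infnorm a / norm a"
    then have b: "\<bar>a $ j\<bar> / norm a \<le> \<tau>" for j
      using divide_right_mono[OF le[of j], of "norm a"] i by simp
    show "optimal \<tau> a 0"
    proof (rule optimal_by_dual_certificate[where y = "(1 / norm a) *\<^sub>R a"])
      show "norm ((1 / norm a) *\<^sub>R a) \<le> 1" using N by simp
      show "\<bar>((1 / norm a) *\<^sub>R a) $ j\<bar> \<le> \<tau>" for j using b[of j] by (simp add: abs_mult)
      show "objective \<tau> a 0 \<le> (1 / norm a) *\<^sub>R a \<bullet> a"
        using N by (simp add: objective_def l0 dot_square_norm power2_eq_square)
    qed
  }
  assume opt: "optimal \<tau> a 0"
  show "\<tau> \<ge> infnorm a / norm a"
  proof (rule ccontr)
    assume "\<not> \<tau> \<ge> infnorm a / norm a"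
    then have lt: "\<tau> * norm a < \<bar>a $ i\<bar>" using N i by (simp add: field_simps)
    define \<epsilon> where "\<epsilon> = \<bar>a $ i\<bar> - \<tau> * norm a"
    define s :: "real ^ 'n" where "s = axis i (\<epsilon> * sgn (a $ i))"
    have e: "\<epsilon> > 0" using lt by (simp add: \<epsilon>_def)
    have ai: "\<bar>a $ i\<bar> \<le> norm a" by (rule component_le_norm_cart)
    then have "\<tau> * norm a < 1 * norm a" using lt by simp
    then have t1: "\<tau> < 1" using N by simp
    have ne: "a $ i \<noteq> 0"
      using lt mult_pos_pos[OF assms(1) N] by (metis abs_zero less_asym)
    have ls: "l1_norm s = \<epsilon>"
    proof -
      have "l1_norm s = (\<Sum>j\<in>UNIV. if j = i then \<epsilon> else 0)"
        unfolding l1_norm_def s_def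
        by (rule sum.cong) (use e ne in \<open>auto simp: axis_def abs_mult abs_sgn_eq\<close>)
      then show ?thesis by simp
    qed
    have sa: "s \<bullet> a = \<epsilon> * \<bar>a $ i\<bar>"
      using ne by (simp add: s_def inner_axis' abs_sgn mult_ac)
    have ss: "s \<bullet> s = \<epsilon>\<^sup>2"
      using ne by (simp add: s_def inner_axis_axis power2_eq_square sgn_if)
    have "(norm (s - a))\<^sup>2 = \<epsilon>\<^sup>2 - 2 * \<epsilon> * \<bar>a $ i\<bar> + (norm a)\<^sup>2"
      by (simp add: power2_norm_eq_inner inner_diff_left inner_diff_right ss sa inner_commute[of a s])
    also have "\<dots> = (norm a - \<tau> * \<epsilon>)\<^sup>2 - \<epsilon>\<^sup>2 * (1 + \<tau>\<^sup>2)"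
      by (simp add: \<epsilon>_def power2_eq_square algebra_simps)
    also have "\<dots> < (norm a - \<tau> * \<epsilon>)\<^sup>2"
      using e by (simp add: add_pos_nonneg)
    finally have sq: "(norm (s - a))\<^sup>2 < (norm a - \<tau> * \<epsilon>)\<^sup>2" .
    have eN: "\<epsilon> \<le> norm a" using ai mult_pos_pos[OF assms(1) N] unfolding \<epsilon>_def by linarith
    have "\<tau> * \<epsilon> \<le> 1 * \<epsilon>"
      by (rule mult_right_mono[OF less_imp_le[OF t1] less_imp_le[OF e]])
    then have "\<tau> * \<epsilon> \<le> norm a" using eN by linarith
    then have "norm (s - a) < norm a - \<tau> * \<epsilon>"
      using power_less_imp_less_base[OF sq] by simp
    then have "objective \<tau> a s < objective \<tau> a 0"
      by (simp add: objective_def ls l0)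
    then show False using opt by (simp add: optimal_iff not_le[symmetric])
  qed
qed

lemma sum_indicator_nonzero:
  fixes a :: "real ^ 'n"
  shows "(\<Sum>i\<in>UNIV. if a $ i \<noteq> 0 then c else 0) = real (l0_norm a) * c"
  by (simp add: l0_norm_def sum.If_cases)

lemma l0_norm_pos: "a \<noteq> 0 \<Longrightarrow> l0_norm a > 0"
  by (auto simp: l0_norm_def card_gt_0_iff vec_eq_iff)

lemma norm_sign_pattern:
  fixes a :: "real ^ 'n"
  assumes "c \<ge> 0"
  shows "norm (\<chi> i. c * sgn (a $ i)) = c * sqrt (real (l0_norm a))"
proof -
  have "(norm (\<chi> i. c * sgn (a $ i)))\<^sup>2 = (\<Sum>i\<in>UNIV. if a $ i \<noteq> 0 then c\<^sup>2 else 0)"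
    unfolding power2_norm_eq_inner inner_vec_def
    by (rule sum.cong) (auto simp: power2_eq_square sgn_if)
  also have "\<dots> = (c * sqrt (real (l0_norm a)))\<^sup>2"
    by (simp add: sum_indicator_nonzero power_mult_distrib mult.commute)
  finally show ?thesis using assms by (simp add: power2_eq_iff_nonneg)
qed

text \<open>Shrinking the \<open>m\<close> nonzero entries of \<open>a\<close> by a small \<open>\<epsilon>\<close> costs \<open>\<epsilon> sqrt m\<close> in distance and
  gains \<open>\<tau> \<epsilon> m\<close> in the penalty.\<close>

lemma optimal_self_iff:
  fixes a :: "real ^ 'n"
  assumes "\<tau> > 0" and "a \<noteq> 0"
  shows "optimal \<tau> a a \<longleftrightarrow> \<tau> \<le> 1 / sqrt (real (l0_norm a))"
proof
  define m where "m = real (l0_norm a)"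
  have m: "m > 0" using l0_norm_pos[OF assms(2)] by (simp add: m_def)
  {
    assume "\<tau> \<le> 1 / sqrt (real (l0_norm a))"
    then have le: "\<tau> * sqrt m \<le> 1" using m by (simp add: m_def field_simps)
    show "optimal \<tau> a a"
    proof (rule optimal_by_dual_certificate[where y = "\<chi> i. \<tau> * sgn (a $ i)"])
      show "norm (\<chi> i. \<tau> * sgn (a $ i)) \<le> 1"
        using le assms by (simp add: norm_sign_pattern m_def)
      show "\<bar>(\<chi> i. \<tau> * sgn (a $ i)) $ i\<bar> \<le> \<tau>" for i
        using assms by (simp add: abs_mult abs_sgn_eq)
      show "objective \<tau> a a \<le> (\<chi> i. \<tau> * sgn (a $ i)) \<bullet> a"
        by (simp add: objective_def l1_norm_def inner_vec_def sum_distrib_left mult.assoc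
            abs_sgn mult.commute[of "sgn _"])
    qed
  }
  assume opt: "optimal \<tau> a a"
  define A where "A = (\<lambda>i. \<bar>a $ i\<bar>) ` {i. a $ i \<noteq> 0}"
  define \<epsilon> where "\<epsilon> = Min A"
  have A: "finite A" "A \<noteq> {}" using assms by (auto simp: A_def vec_eq_iff)
  have e: "\<epsilon> > 0" using Min_in[OF A] by (auto simp: \<epsilon>_def A_def)
  have le: "\<epsilon> \<le> \<bar>a $ i\<bar>" if "a $ i \<noteq> 0" for i
    unfolding \<epsilon>_def by (rule Min_le) (use A that in \<open>auto simp: A_def\<close>)
  let ?d = "\<chi> i. \<epsilon> * sgn (a $ i)"
  have d: "norm (- ?d) = \<epsilon> * sqrt m"
    using e by (simp only: norm_minus_cancel norm_sign_pattern m_def less_imp_le)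
  have "l1_norm (a - ?d) = (\<Sum>i\<in>UNIV. \<bar>a $ i\<bar> - (if a $ i \<noteq> 0 then \<epsilon> else 0))"
    unfolding l1_norm_def
  proof (rule sum.cong)
    show "\<bar>(a - ?d) $ i\<bar> = \<bar>a $ i\<bar> - (if a $ i \<noteq> 0 then \<epsilon> else 0)" for i
      using le[of i] e by (cases "a $ i" "0 :: real" rule: linorder_cases) auto
  qed simp
  also have "\<dots> = l1_norm a - m * \<epsilon>"
    by (simp only: sum_subtractf sum_indicator_nonzero l1_norm_def m_def)
  finally have l: "l1_norm (a - ?d) = l1_norm a - m * \<epsilon>" .
  have "objective \<tau> a a \<le> objective \<tau> a (a - ?d)" using opt by (simp add: optimal_iff)
  then have "\<tau> * (m * \<epsilon>) \<le> \<epsilon> * sqrt m"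
    using d by (simp add: objective_def l right_diff_distrib)
  then have "\<tau> * (sqrt m * sqrt m) \<le> sqrt m" using e m by (simp add: field_simps)
  then have "\<tau> * sqrt m \<le> 1" using m
    by (metis mult.assoc mult_1 mult_le_cancel_right_pos real_sqrt_gt_zero)
  then show "\<tau> \<le> 1 / sqrt (real (l0_norm a))" using m by (simp add: m_def field_simps)
qed

section \<open>Optimality of a soft-thresholded vector\<close>

text \<open>The certificate is the residual \<open>w = min a t\<close> scaled to unit length. It equals \<open>\<tau>\<close> wherever the
  thresholded vector is nonzero, which makes both summands of the dual bound tight.\<close>

lemma optimal_soft_threshold:
  fixes a :: "real ^ 'n"
  assumes "\<tau> > 0" and "t > 0" and nonneg: "\<And>i. a $ i \<ge> 0"
    and eq: "\<tau>\<^sup>2 * (\<Sum>i\<in>UNIV. (min (a $ i) t)\<^sup>2) = t\<^sup>2"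
  shows "optimal \<tau> a (max_zero (a - t *\<^sub>R vec 1))"
proof -
  define s where "s = max_zero (a - t *\<^sub>R vec 1)"
  define w :: "real ^ 'n" where "w = (\<chi> i. min (a $ i) t)"
  have s: "s $ i = max (a $ i - t) 0" for i by (simp add: s_def max_zero_def)
  have w: "w $ i = min (a $ i) t" for i by (simp add: w_def)
  have sa: "s - a = - w" by (auto simp: vec_eq_iff s w)
  have ww: "w \<bullet> w = (\<Sum>i\<in>UNIV. (min (a $ i) t)\<^sup>2)"
    by (simp add: inner_vec_def w power2_eq_square)
  have "(\<tau> * norm w)\<^sup>2 = t\<^sup>2"
    using eq by (simp add: power_mult_distrib power2_norm_eq_inner ww)
  then have nw: "\<tau> * norm w = t"
    using assms by (simp add: power2_eq_iff_nonneg)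
  have "w \<bullet> a = w \<bullet> w + (\<Sum>i\<in>UNIV. t * \<bar>s $ i\<bar>)"
    unfolding inner_vec_def sum.distrib[symmetric]
    by (rule sum.cong) (auto simp: s w min_def max_def algebra_simps)
  then have wa: "w \<bullet> a = w \<bullet> w + t * l1_norm s"
    by (simp add: l1_norm_def sum_distrib_left)
  have "optimal \<tau> a s"
  proof (rule optimal_by_dual_certificate[where y = "(\<tau> / t) *\<^sub>R w"])
    show "norm ((\<tau> / t) *\<^sub>R w) \<le> 1" using assms nw by simp
    show "\<bar>((\<tau> / t) *\<^sub>R w) $ i\<bar> \<le> \<tau>" for i
    proof -
      have "\<bar>w $ i\<bar> \<le> t" using nonneg[of i] assms by (simp add: w min_def)
      then show ?thesis
        using assms by (simp add: abs_mult field_simps)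
    qed
    have "(\<tau> / t) *\<^sub>R w \<bullet> a = (\<tau> * norm w) / t * norm w + \<tau> * l1_norm s"
      using assms by (simp add: wa dot_square_norm power2_eq_square field_simps)
    then show "objective \<tau> a s \<le> (\<tau> / t) *\<^sub>R w \<bullet> a"
      using assms nw by (simp add: objective_def sa)
  qed
  then show ?thesis by (simp add: s_def)
qed

section \<open>Selecting the threshold\<close>

lemma unique_sign_change:
  fixes h :: "nat \<Rightarrow> real"
  assumes mono: "\<And>k. 1 \<le> k \<Longrightarrow> k \<le> K \<Longrightarrow> h (k - 1) \<le> h k"
    and "h 0 < 0" and "h K \<ge> 0"
  shows "\<exists>!k. 1 \<le> k \<and> k \<le> K \<and> h (k - 1) < 0 \<and> 0 \<le> h k"
proof -
  have le: "h i \<le> h j" if "i \<le> j" "j \<le> K" for i j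
    using that
  proof (induction j rule: dec_induct)
    case (step j)
    then show ?case using mono[of "Suc j"] by simp
  qed simp
  define k where "k = (LEAST k. 0 \<le> h k)"
  have k: "0 \<le> h k" unfolding k_def by (rule LeastI) (rule assms(3))
  have kK: "k \<le> K" unfolding k_def by (rule Least_le) (rule assms(3))
  have k0: "k \<noteq> 0" using k assms(2) by (metis not_le)
  have "h (k - 1) < 0"
    using not_less_Least[of "k - 1" "\<lambda>k. 0 \<le> h k"] k0 by (auto simp: k_def[symmetric])
  then show ?thesis
  proof (intro ex1I[of _ k])
    fix j assume j: "1 \<le> j \<and> j \<le> K \<and> h (j - 1) < 0 \<and> 0 \<le> h j"
    have "\<not> k \<le> j - 1"
    proof
      assume "k \<le> j - 1"
      then have "h k \<le> h (j - 1)" using j by (intro le) auto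
      then show False using j k by linarith
    qed
    moreover have "\<not> j \<le> k - 1"
    proof
      assume "j \<le> k - 1"
      then have "h j \<le> h (k - 1)" using kK by (intro le) auto
      then show False using j \<open>h (k - 1) < 0\<close> by linarith
    qed
    ultimately show "j = k" using j k0 by linarith
  qed (use k kK k0 in auto)
qed

text \<open>Both conditions on the threshold are sign conditions on one nondecreasing sequence \<open>h\<close>, taken at
  \<open>k\<close> and at \<open>k - 1\<close>. The hypotheses make \<open>K\<close> the largest integer below \<open>r\<close>, so that \<open>r - K \<le> 1\<close>: the
  term subtracted in \<open>h K\<close> is then at most the first summand of its sum.\<close>

lemma ex1_threshold_index:
  fixes b :: "nat \<Rightarrow> real"
  assumes dec: "\<And>i. 1 \<le> i \<Longrightarrow> i < n \<Longrightarrow> b (i + 1) \<le> b i"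
    and nonneg: "\<And>i. 1 \<le> i \<Longrightarrow> i \<le> n \<Longrightarrow> 0 \<le> b i"
    and K: "real K < r" "r \<le> real K + 1" "K < n"
    and first: "(\<Sum>j = 1..n. (b j)\<^sup>2) < r * (b 1)\<^sup>2"
  shows "\<exists>!k. 1 \<le> k \<and> k \<le> K \<and> b (k + 1) \<le> sqrt ((\<Sum>j = k + 1..n. (b j)\<^sup>2) / (r - real k))
           \<and> sqrt ((\<Sum>j = k + 1..n. (b j)\<^sup>2) / (r - real k)) < b k"
proof -
  define S where "S k = (\<Sum>j = k + 1..n. (b j)\<^sup>2)" for k
  define h where "h k = S k - (r - real k) * (b (k + 1))\<^sup>2" for k
  have S: "S (k - 1) = (b k)\<^sup>2 + S k" if "1 \<le> k" "k \<le> n" for k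
    using that sum.atLeast_Suc_atMost[of k n "\<lambda>j. (b j)\<^sup>2"] by (simp add: S_def)
  have hk: "h (k - 1) = S k - (r - real k) * (b k)\<^sup>2" if "1 \<le> k" "k \<le> n" for k
    using that S[OF that] by (simp add: h_def of_nat_diff algebra_simps)
  have "h (k - 1) \<le> h k" if "1 \<le> k" "k \<le> K" for k
  proof -
    have "(b (k + 1))\<^sup>2 \<le> (b k)\<^sup>2"
      using that K by (intro power_mono dec nonneg) auto
    moreover have "0 \<le> r - real k" using that K by simp
    ultimately have "(r - real k) * (b (k + 1))\<^sup>2 \<le> (r - real k) * (b k)\<^sup>2"
      by (rule mult_left_mono)
    then show ?thesis using that K hk[of k] by (simp add: h_def)
  qed
  moreover have "h 0 < 0" using first by (simp add: h_def S_def)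
  moreover have "h K \<ge> 0"
  proof -
    have "(r - real K) * (b (K + 1))\<^sup>2 \<le> 1 * (b (K + 1))\<^sup>2"
      using K by (intro mult_right_mono) auto
    also have "\<dots> \<le> S K"
      unfolding S_def mult_1 by (rule member_le_sum) (use K in auto)
    finally show ?thesis by (simp add: h_def)
  qed
  ultimately have "\<exists>!k. 1 \<le> k \<and> k \<le> K \<and> h (k - 1) < 0 \<and> 0 \<le> h k"
    by (rule unique_sign_change)
  moreover have "b (k + 1) \<le> sqrt (S k / (r - real k)) \<and> sqrt (S k / (r - real k)) < b k
      \<longleftrightarrow> h (k - 1) < 0 \<and> 0 \<le> h k" if "1 \<le> k" "k \<le> K" for k
  proof -
    have pos: "r - real k > 0" using that K by simp
    have nn: "b k \<ge> 0" "b (k + 1) \<ge> 0" using that K by (auto intro!: nonneg)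
    have S0: "S k \<ge> 0" by (simp add: S_def sum_nonneg)
    have "b (k + 1) \<le> sqrt (S k / (r - real k)) \<longleftrightarrow> (b (k + 1))\<^sup>2 \<le> S k / (r - real k)"
      using nn by (metis real_sqrt_abs abs_of_nonneg real_sqrt_le_iff)
    also have "\<dots> \<longleftrightarrow> 0 \<le> h k" using pos by (simp add: h_def field_simps)
    finally have 1: "b (k + 1) \<le> sqrt (S k / (r - real k)) \<longleftrightarrow> 0 \<le> h k" .
    have "sqrt (S k / (r - real k)) < b k \<longleftrightarrow> S k / (r - real k) < (b k)\<^sup>2"
      using nn by (metis real_sqrt_abs abs_of_nonneg real_sqrt_less_iff)
    also have "\<dots> \<longleftrightarrow> h (k - 1) < 0"
      using pos that K hk[of k] by (simp add: pos_divide_less_eq mult.commute)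
    finally show ?thesis using 1 by blast
  qed
  ultimately show ?thesis unfolding S_def[symmetric] by metis
qed

lemma Greatest_int_less:
  "(GREATEST m :: int. real_of_int m < r) = \<lceil>r\<rceil> - 1"
  by (rule Greatest_equality) (linarith+)

section \<open>The sorted problem\<close>

lemma l0_norm_le_card: "l0_norm (a :: real ^ 'n) \<le> CARD('n)"
  unfolding l0_norm_def by (rule card_mono) auto

lemma antitone_from_steps:
  fixes b :: "nat \<Rightarrow> real"
  assumes "\<And>i. 1 \<le> i \<Longrightarrow> i < n \<Longrightarrow> b (i + 1) \<le> b i" and "1 \<le> i" and "i \<le> j" and "j \<le> n"
  shows "b j \<le> b i"
  using assms(3,4)
proof (induction j rule: dec_induct)
  case (step j)
  then show ?case using assms(1)[of j] assms(2) by simp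
qed simp

theorem theorem2:
  fixes \<tau> :: real and a :: "real ^ 'n" and e :: "nat \<Rightarrow> 'n"
  assumes "bij_betw e {1..CARD('n)} UNIV"
    and "\<tau> > 0"
    and "\<And>i. 1 \<le> i \<Longrightarrow> i < CARD('n) \<Longrightarrow> a $ e i \<ge> a $ e (i + 1)"
    and "a $ e CARD('n) \<ge> 0"
    and "a \<noteq> 0"
  shows
    "(optimal \<tau> a 0 \<longleftrightarrow> \<tau> \<ge> infnorm a / norm a) \<and>
     (optimal \<tau> a a \<longleftrightarrow> 0 < \<tau> \<and> \<tau> \<le> 1 / sqrt (real (l0_norm a))) \<and>
     (\<tau> \<in> {1 / sqrt (real (l0_norm a)) <..< infnorm a / norm a} \<longrightarrow>
       (let kbar = (GREATEST m :: int. real_of_int m < 1 / \<tau>\<^sup>2);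
            t = threshold e \<tau> a;
            P = (\<lambda>k :: nat. 1 \<le> k \<and> int k \<le> kbar \<and> a $ e (k + 1) \<le> t k \<and> t k < a $ e k)
        in 1 \<le> kbar \<and> kbar \<le> int (l0_norm a) - 1 \<and> int (l0_norm a) - 1 \<le> int CARD('n) - 1 \<and>
           (\<exists>!k. P k) \<and>
           (\<forall>k. P k \<longrightarrow>
             (let s = max_zero (a - t k *\<^sub>R vec 1)
              in s = (\<chi> i. if i \<in> e ` {1..k} then a $ i - t k else 0) \<and> optimal \<tau> a s))))"
proof -
  let ?n = "CARD('n)"
  define b where "b j = a $ e j" for j
  define r where "r = 1 / \<tau>\<^sup>2"
  have dec: "\<And>i. 1 \<le> i \<Longrightarrow> i < ?n \<Longrightarrow> b (i + 1) \<le> b i"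
    using assms(3) by (simp add: b_def)
  have anti: "b j \<le> b i" if "1 \<le> i" "i \<le> j" "j \<le> ?n" for i j
    using dec that by (rule antitone_from_steps)
  have nonneg: "0 \<le> b i" if "1 \<le> i" "i \<le> ?n" for i
    using anti[of i ?n] that assms(4) by (simp add: b_def)
  have surj: "\<exists>j. 1 \<le> j \<and> j \<le> ?n \<and> i = e j" for i
    using assms(1) by (metis UNIV_I atLeastAtMost_iff bij_betw_imp_surj_on imageE)
  have inj: "e i = e j \<longleftrightarrow> i = j" if "i \<in> {1..?n}" "j \<in> {1..?n}" for i j
    using assms(1) that by (meson bij_betw_imp_inj_on inj_on_eq_iff)
  have a0: "a $ i \<ge> 0" for i using surj[of i] nonneg by (auto simp: b_def)
  have sum_e: "(\<Sum>i\<in>UNIV. f (a $ i)) = (\<Sum>j = 1..?n. f (b j))" for f :: "real \<Rightarrow> real"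
    using sum.reindex_bij_betw[OF assms(1), of "\<lambda>i. f (a $ i)"] by (simp add: b_def)
  have part3: "let kbar = (GREATEST m :: int. real_of_int m < 1 / \<tau>\<^sup>2);
            t = threshold e \<tau> a;
            P = (\<lambda>k :: nat. 1 \<le> k \<and> int k \<le> kbar \<and> a $ e (k + 1) \<le> t k \<and> t k < a $ e k)
        in 1 \<le> kbar \<and> kbar \<le> int (l0_norm a) - 1 \<and> int (l0_norm a) - 1 \<le> int CARD('n) - 1 \<and>
           (\<exists>!k. P k) \<and>
           (\<forall>k. P k \<longrightarrow>
             (let s = max_zero (a - t k *\<^sub>R vec 1)
              in s = (\<chi> i. if i \<in> e ` {1..k} then a $ i - t k else 0) \<and> optimal \<tau> a s))"
    if lo: "1 / sqrt (real (l0_norm a)) < \<tau>" and hi: "\<tau> < infnorm a / norm a"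
  proof -
    define m where "m = l0_norm a"
    define K where "K = nat (\<lceil>r\<rceil> - 1)"
    have m0: "m > 0" using l0_norm_pos[OF assms(5)] by (simp add: m_def)
    have mn: "m \<le> ?n" unfolding m_def by (rule l0_norm_le_card)
    have N: "norm a > 0" using assms by simp
    have rm: "r < real m"
    proof -
      have "1 < \<tau> * sqrt (real m)" using lo m0 by (simp add: m_def field_simps)
      then have "1 < (\<tau> * sqrt (real m))\<^sup>2" by (rule one_less_power) simp
      then show ?thesis
        using assms(2) by (simp add: r_def power_mult_distrib field_simps)
    qed
    obtain i where i: "infnorm a = \<bar>a $ i\<bar>" by (rule infnorm_attained[of a])
    obtain ji where ji: "1 \<le> ji" "ji \<le> ?n" "i = e ji" using surj by blast
    have i1: "infnorm a \<le> b 1"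
      using anti[of 1 ji] a0[of i] ji i by (simp add: b_def)
    have b1N: "b 1 \<le> norm a"
      unfolding b_def using component_le_norm_cart[of a "e 1"] by simp
    have "\<tau> * norm a < b 1" using hi i1 N by (simp add: field_simps)
    then have "(\<tau> * norm a)\<^sup>2 < (b 1)\<^sup>2"
      using assms(2) N by (intro power_strict_mono) auto
    then have rb: "(norm a)\<^sup>2 < r * (b 1)\<^sup>2"
      using assms(2) by (simp add: r_def power_mult_distrib field_simps)
    have "(b 1)\<^sup>2 \<le> (norm a)\<^sup>2" using b1N nonneg[of 1] by (intro power_mono) auto
    then have "1 * (b 1)\<^sup>2 < r * (b 1)\<^sup>2" using rb by simp
    then have r1: "r > 1" by (metis mult_less_cancel_right zero_le_power2 not_le)
    have Kint: "int K = \<lceil>r\<rceil> - 1" using r1 by (simp add: K_def)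
    have Kr: "real K < r" "r \<le> real K + 1" "1 \<le> K" "K < m"
      using Kint r1 rm by linarith+
    have sq: "(norm a)\<^sup>2 = (\<Sum>j = 1..?n. (b j)\<^sup>2)"
      using sum_e[of "\<lambda>x. x\<^sup>2"] unfolding power2_norm_eq_inner inner_vec_def
      by (simp add: power2_eq_square)
    have th: "threshold e \<tau> a k = sqrt ((\<Sum>j = k + 1..?n. (b j)\<^sup>2) / (r - real k))" for k
      by (simp add: threshold_def b_def r_def)
    have ex1: "\<exists>!k. 1 \<le> k \<and> k \<le> K \<and> b (k + 1) \<le> threshold e \<tau> a k \<and> threshold e \<tau> a k < b k"
      unfolding th
      by (rule ex1_threshold_index) (use dec nonneg Kr mn rb sq in auto)
    have opt: "max_zero (a - threshold e \<tau> a k *\<^sub>R vec 1)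
          = (\<chi> i. if i \<in> e ` {1..k} then a $ i - threshold e \<tau> a k else 0)
        \<and> optimal \<tau> a (max_zero (a - threshold e \<tau> a k *\<^sub>R vec 1))"
      if k: "1 \<le> k" "k \<le> K" and lo: "b (k + 1) \<le> threshold e \<tau> a k"
        and hi: "threshold e \<tau> a k < b k" for k
    proof
      define t where "t = threshold e \<tau> a k"
      have kn: "k < ?n" using k Kr mn by simp
      have above: "t < b j" if "1 \<le> j" "j \<le> k" for j
        using anti[of j k] that hi kn by (simp add: t_def)
      have below: "b j \<le> t" if "k < j" "j \<le> ?n" for j
        using anti[of "k + 1" j] that lo by (simp add: t_def)
      have "0 < b (k + 1)"
      proof (rule ccontr)
        \<comment> \<open>If the entry after the first \<open>k\<close> vanished, all later ones would too, leaving at most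
          \<open>k < m\<close> nonzero entries.\<close>
        assume "\<not> 0 < b (k + 1)"
        then have z: "b j = 0" if "k < j" "j \<le> ?n" for j
          using anti[of "k + 1" j] nonneg[of j] that by auto
        have "{i. a $ i \<noteq> 0} \<subseteq> e ` {1..k}"
        proof
          fix i assume "i \<in> {i. a $ i \<noteq> 0}"
          moreover obtain j where "1 \<le> j" "j \<le> ?n" "i = e j" using surj by blast
          ultimately show "i \<in> e ` {1..k}"
            using z[of j] by (cases "k < j") (auto simp: b_def)
        qed
        then have "m \<le> card (e ` {1..k})"
          unfolding m_def l0_norm_def by (intro card_mono) auto
        also have "\<dots> \<le> k" using card_image_le[of "{1..k}" e] by simp
        finally show False using k Kr by simp
      qed
      then have t0: "t > 0" using lo by (simp add: t_def)
      show "max_zero (a - threshold e \<tau> a k *\<^sub>R vec 1)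
          = (\<chi> i. if i \<in> e ` {1..k} then a $ i - threshold e \<tau> a k else 0)"
        unfolding t_def[symmetric] vec_eq_iff
      proof
        fix i
        obtain j where j: "1 \<le> j" "j \<le> ?n" "i = e j" using surj by blast
        have "i \<in> e ` {1..k} \<longleftrightarrow> j \<le> k" using j kn inj by auto
        then show "max_zero (a - t *\<^sub>R vec 1) $ i
            = (\<chi> i. if i \<in> e ` {1..k} then a $ i - t else 0) $ i"
          using above[of j] below[of j] j by (auto simp: max_zero_def b_def)
      qed
      have pos: "r - real k > 0" using k Kr by simp
      have "t\<^sup>2 = (\<Sum>j = k + 1..?n. (b j)\<^sup>2) / (r - real k)"
        unfolding t_def th using pos by (intro real_sqrt_pow2) (simp add: sum_nonneg)
      then have teq: "(\<Sum>j = k + 1..?n. (b j)\<^sup>2) = (r - real k) * t\<^sup>2"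
        using pos by (simp add: field_simps)
      have "(\<Sum>i\<in>UNIV. (min (a $ i) t)\<^sup>2) = (\<Sum>j = 1..?n. (min (b j) t)\<^sup>2)"
        by (rule sum_e)
      also have "\<dots> = (\<Sum>j = 1..k. (min (b j) t)\<^sup>2) + (\<Sum>j = k + 1..?n. (min (b j) t)\<^sup>2)"
        using kn k sum.ub_add_nat[of 1 k "\<lambda>j. (min (b j) t)\<^sup>2" "?n - k"] by simp
      also have "(\<Sum>j = 1..k. (min (b j) t)\<^sup>2) = (\<Sum>j = 1..k. t\<^sup>2)"
        by (rule sum.cong) (use above in \<open>auto simp: min_absorb2 less_imp_le\<close>)
      also have "(\<Sum>j = k + 1..?n. (min (b j) t)\<^sup>2) = (\<Sum>j = k + 1..?n. (b j)\<^sup>2)"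
        by (rule sum.cong) (use below in \<open>auto simp: min_def\<close>)
      also have "(\<Sum>j = 1..k. t\<^sup>2) + (\<Sum>j = k + 1..?n. (b j)\<^sup>2) = r * t\<^sup>2"
        unfolding teq by (simp add: algebra_simps)
      finally have "\<tau>\<^sup>2 * (\<Sum>i\<in>UNIV. (min (a $ i) t)\<^sup>2) = t\<^sup>2"
        using assms(2) by (simp add: r_def)
      then show "optimal \<tau> a (max_zero (a - threshold e \<tau> a k *\<^sub>R vec 1))"
        unfolding t_def[symmetric] using assms(2) t0 a0 by (intro optimal_soft_threshold)
    qed
    show ?thesis
      unfolding Let_def r_def[symmetric] Greatest_int_less Kint[symmetric] of_nat_le_iff
        m_def[symmetric] b_def[symmetric]
    proof (intro conjI)
      show "1 \<le> int K" "int K \<le> int m - 1" "int m - 1 \<le> int CARD('n) - 1"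
        using Kr mn by auto
    qed (use ex1 opt in blast)+
  qed
  show ?thesis
  proof (intro conjI impI)
    show "optimal \<tau> a 0 \<longleftrightarrow> \<tau> \<ge> infnorm a / norm a"
      by (rule optimal_zero_iff[OF assms(2,5)])
    show "optimal \<tau> a a \<longleftrightarrow> 0 < \<tau> \<and> \<tau> \<le> 1 / sqrt (real (l0_norm a))"
      using optimal_self_iff[OF assms(2,5)] assms(2) by blast
  qed (rule part3; simp)
qed

end
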